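(* Let $T$ be a rooted tree with nonnegative real node weights, let $K \ge 1$, and let $S$ be a summary tree of $T$ with $k \le K$ nodes. For every node $v$ of $T$ such that $S$ contains a group node $other_v$, the number of children of $v$ represented by $other_v$ is at least $d_v - K + 2$, where $d_v$ is the number of children of $v$ in $T$.
   Context: For a node $v$ of $T$, $T_v$ denotes the subtree rooted at $v$ and $V(T_v)$ its node set. Summary trees are trees whose nodes are labeled by sets of nodes of $T$, defined recursively. If $T_v$ has one node, the only summary tree for $T_v$ is the single node $\{v\}$. Otherwise a summary tree for $T_v$ is one of: (1) the one-node tree $V(T_v)$; (2) a root $\{v\}$ together with, for each child $x$ of $v$, a summary tree for $T_x$ whose root is made a child of $\{v\}$; (3) a root $\{v\}$, a child node $other_v$ representing a non-empty subset $U_v$ of the children of $v$ together with all their descendants (the node $\bigcup_{x\in U_v} V(T_x)$), and for each child $x\notin U_v$ of $v$ a summary tree for $T_x$ whose root is made a child of $\{v\}$. A summary tree of $T$ is a summary tree for $T_r$, $r$ the root of $T$. *)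

theory Defs
  imports Complex_Main "HOL-Library.Multiset"
begin

(* A finite rooted tree with node set V, root r and parent-child relation E;
   (u, v) \<in> E means that v is a child of u. *)
locale rooted_tree =
  fixes V :: "'a set" and r :: 'a and E :: "('a \<times> 'a) set"
  assumes finite_nodes: "finite V"
    and root_in: "r \<in> V"
    and edges_in: "E \<subseteq> V \<times> V"
    and root_no_parent: "\<And>u. (u, r) \<notin> E"
    and unique_parent: "\<And>v. v \<in> V \<Longrightarrow> v \<noteq> r \<Longrightarrow> \<exists>!u. (u, v) \<in> E"
    and reachable: "\<And>v. v \<in> V \<Longrightarrow> (r, v) \<in> E\<^sup>*"

locale weighted_rooted_tree = rooted_tree V r E
  for V :: "'a set" and r :: 'a and E :: "('a \<times> 'a) set" +
  fixes w :: "'a \<Rightarrow> real"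
  assumes weight_nonneg: "\<And>v. v \<in> V \<Longrightarrow> 0 \<le> w v"

definition children :: "('a \<times> 'a) set \<Rightarrow> 'a \<Rightarrow> 'a set" where
  "children E v = {x. (v, x) \<in> E}"

(* V(T_v) *)
definition subtree_nodes :: "('a \<times> 'a) set \<Rightarrow> 'a \<Rightarrow> 'a set" where
  "subtree_nodes E v = {x. (v, x) \<in> E\<^sup>*}"

(* Unordered rooted trees with labelled nodes. *)
datatype (nodes: 'l) ltree = LNode 'l "'l ltree multiset"

primrec num_nodes :: "'l ltree \<Rightarrow> nat" where
  "num_nodes (LNode l ts) = Suc (\<Sum>n \<in># image_mset num_nodes ts. n)"

(* A node of a summary tree carries its set of nodes of T.  The constructor Other v marks
   the group node other_v; the mark is needed because a group node that represents a single
   child x carries the same set V(T_x) as the one-node summary tree for T_x. *)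
datatype 'a snode = Plain "'a set" | Other 'a "'a set"

inductive summary_tree_for :: "('a \<times> 'a) set \<Rightarrow> 'a \<Rightarrow> 'a snode ltree \<Rightarrow> bool"
  for E :: "('a \<times> 'a) set" where
  single:
    "subtree_nodes E v = {v} \<Longrightarrow> summary_tree_for E v (LNode (Plain {v}) {#})"
| collapse:
    "subtree_nodes E v \<noteq> {v} \<Longrightarrow>
     summary_tree_for E v (LNode (Plain (subtree_nodes E v)) {#})"
| expand:
    "subtree_nodes E v \<noteq> {v} \<Longrightarrow>
     (\<And>x. x \<in> children E v \<Longrightarrow> summary_tree_for E x (s x)) \<Longrightarrow>
     summary_tree_for E v (LNode (Plain {v}) {# s x. x \<in># mset_set (children E v) #})"
| group:
    "subtree_nodes E v \<noteq> {v} \<Longrightarrow>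
     U \<subseteq> children E v \<Longrightarrow> U \<noteq> {} \<Longrightarrow>
     (\<And>x. x \<in> children E v - U \<Longrightarrow> summary_tree_for E x (s x)) \<Longrightarrow>
     summary_tree_for E v
       (LNode (Plain {v})
         (add_mset (LNode (Other v (\<Union>x\<in>U. subtree_nodes E x)) {#})
           {# s x. x \<in># mset_set (children E v - U) #}))"

end

theory Submission
  imports Defs
begin

text \<open>If \<open>S\<close> contains the group node of \<open>v\<close>, it also contains the
  node \<open>{v}\<close> and, for each child of \<open>v\<close> outside the group, a separate
  summary tree with at least one node. Hence \<open>S\<close> has at least 2 nodes plus one per
  ungrouped child, which rearranges to the claim. \<open>group_card_bound\<close> carries this count
  through the recursion.\<close>

lemma num_nodes_pos: "1 \<le> num_nodes t"
  by (cases t) simp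

text \<open>Induction over the construction of \<open>S\<close>, with \<open>v\<close> and
  \<open>X\<close> fixed while the root \<open>u\<close> varies: a bound reached inside a subtree
  survives in every larger tree. The additive form avoids truncated subtraction on
  \<open>nat\<close>.\<close>

lemma group_card_bound:
  assumes "summary_tree_for E u S" "Other v X \<in> nodes S" "\<And>x. finite (children E x)"
  shows "card (children E v) + 2 \<le> card (children E v \<inter> X) + num_nodes S"
  using assms(1,2)
proof (induction rule: summary_tree_for.induct)
  case (single u)
  then show ?case by simp
next
  case (collapse u)
  then show ?case by simp
next
  case (expand u s)
  from expand.prems assms(3)[of u] obtain x
    where x: "x \<in> children E u" "Other v X \<in> nodes (s x)"
    by auto
  have "num_nodes (s x) \<le> (\<Sum>y\<in>children E u. num_nodes (s y))"
    using x assms(3)[of u] by (intro member_le_sum) auto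
  with expand.IH[OF x] show ?case
    by (simp add: multiset.map_comp comp_def sum_unfold_sum_mset)
next
  case (group u U s)
  let ?C = "children E u - U"
  let ?G = "\<Union>x\<in>U. subtree_nodes E x"
  have fin: "finite ?C" "finite U"
    using assms(3)[of u] group.hyps(2) finite_subset by auto
  \<comment> \<open>The 2 counts the root \<open>{u}\<close> and its group node.\<close>
  have num: "num_nodes (LNode (Plain {u})
      (add_mset (LNode (Other u ?G) {#}) {# s x. x \<in># mset_set ?C #}))
      = 2 + (\<Sum>y\<in>?C. num_nodes (s y))"
    by (simp add: multiset.map_comp comp_def sum_unfold_sum_mset)
  \<comment> \<open>The group node is either the one created here or lies deeper, below an ungrouped
    child.\<close>
  from group.prems fin consider "v = u" "X = ?G"
    | x where "x \<in> ?C" "Other v X \<in> nodes (s x)"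
    by auto
  then show ?case
  proof cases
    case 1
    \<comment> \<open>Each child lies in its own subtree by reflexivity; as
      \<open>card (children E v \<inter> X)\<close> is bounded from below, inclusion
      suffices.\<close>
    have "U \<subseteq> children E u \<inter> ?G"
      using group.hyps(2) by (auto simp: subtree_nodes_def)
    then have "card U \<le> card (children E u \<inter> ?G)"
      using assms(3)[of u] by (intro card_mono) auto
    moreover have "card ?C \<le> (\<Sum>y\<in>?C. num_nodes (s y))"
      using sum_bounded_below[of ?C 1 "\<lambda>y. num_nodes (s y)"] num_nodes_pos by auto
    moreover have "card ?C + card U = card (children E u)"
      using group.hyps(2) assms(3)[of u] fin card_mono[of "children E u" U]
      by (simp add: card_Diff_subset)
    ultimately show ?thesis
      unfolding num 1 by linarith
  next
    case (2 x)
    have "num_nodes (s x) \<le> (\<Sum>y\<in>?C. num_nodes (s y))"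
      using 2 fin by (intro member_le_sum) auto
    with group.IH[OF 2] show ?thesis
      unfolding num by linarith
  qed
qed

theorem theorem2:
  fixes V :: "'a set" and r :: 'a and E :: "('a \<times> 'a) set" and w :: "'a \<Rightarrow> real"
    and S :: "'a snode ltree" and K :: nat
  assumes "weighted_rooted_tree V r E w"
    and "K \<ge> 1"
    and "summary_tree_for E r S"
    and "num_nodes S \<le> K"
  shows "\<forall>v\<in>V. \<forall>X. Other v X \<in> nodes S \<longrightarrow>
           int (card (children E v \<inter> X)) \<ge> int (card (children E v)) - int K + 2"
proof (intro ballI allI impI)
  fix v X
  assume "Other v X \<in> nodes S"
  moreover have "finite (children E x)" for x
  proof -
    interpret weighted_rooted_tree V r E w by fact
    show ?thesis
      using edges_in finite_nodes by (auto simp: children_def intro: finite_subset[of _ V])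
  qed
  ultimately have "card (children E v) + 2 \<le> card (children E v \<inter> X) + num_nodes S"
    using group_card_bound[OF assms(3)] by blast
  then show "int (card (children E v \<inter> X)) \<ge> int (card (children E v)) - int K + 2"
    using assms(4) by linarith
qed

end
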